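(* Let $X(q)=Aq$ on $\mathbb{H}^n$, with $A\in GL(n,\mathbb{H})$ and $n\ge2$, and let $\mathcal{D}_X(q)=Aq\,\mathbb{H}$. Then $\mathcal{D}_X$ is involutive on $\mathbb{H}^n\setminus\{0\}$ if and only if $$A=\mu I,\qquad\mu\in\mathbb{R}^*.$$ Hence every right-$\mathbb{H}$-linear isolated-singularity model $X(q)=Aq$ with an involutive quaternionic rank-one distribution $\mathcal{D}_X$ induces on $\mathbb{S}^{4n-1}$ exactly the Hopf foliation by $\mathbb{S}^3$'s.
   Context: $\mathbb{H}$ denotes the quaternions. Matrices in $M_n(\mathbb{H})$ act on column vectors in $\mathbb{H}^n$ from the left, so $A(qa)=(Aq)a$ for $a\in\mathbb{H}$. For a vector field $X$ on an open subset of $\mathbb{H}^n$ (viewed as an $\mathbb{H}^n$-valued map), at points with $X(q)\ne0$ put $\mathcal{D}_X(q)=X(q)\mathbb{H}=\{X(q)a:a\in\mathbb{H}\}=\operatorname{span}_{\mathbb R}\{X(q),X(q)i,X(q)j,X(q)k\}$, a real four-plane distribution. Involutive is meant in the sense of Frobenius (closed under Lie brackets of sections). The Hopf foliation of $\mathbb{S}^{4n-1}$ is the foliation by the orbits $q\operatorname{Sp}(1)$ of right multiplication by unit quaternions; the foliation induced on $\mathbb{S}^{4n-1}$ is the one obtained by intersecting the leaves of $\mathcal{D}_X$ with the unit sphere. *)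

theory Defs
  imports "HOL-Analysis.Analysis"
begin

section \<open>Quaternions\<close>

codatatype quat = Quat (qRe: real) (qIm1: real) (qIm2: real) (qIm3: real)

lemma quat_eqI [intro?]:
  "\<lbrakk>qRe x = qRe y; qIm1 x = qIm1 y; qIm2 x = qIm2 y; qIm3 x = qIm3 y\<rbrakk> \<Longrightarrow> x = y"
  by (rule quat.expand) simp

lemma quat_eq_iff:
  "x = y \<longleftrightarrow> qRe x = qRe y \<and> qIm1 x = qIm1 y \<and> qIm2 x = qIm2 y \<and> qIm3 x = qIm3 y"
  by (auto intro: quat_eqI)

instantiation quat :: ab_group_add
begin

primcorec zero_quat where
  "qRe 0 = 0" | "qIm1 0 = 0" | "qIm2 0 = 0" | "qIm3 0 = 0"

primcorec plus_quat where
  "qRe (x + y) = qRe x + qRe y"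
| "qIm1 (x + y) = qIm1 x + qIm1 y"
| "qIm2 (x + y) = qIm2 x + qIm2 y"
| "qIm3 (x + y) = qIm3 x + qIm3 y"

primcorec uminus_quat where
  "qRe (- x) = - qRe x"
| "qIm1 (- x) = - qIm1 x"
| "qIm2 (- x) = - qIm2 x"
| "qIm3 (- x) = - qIm3 x"

primcorec minus_quat where
  "qRe (x - y) = qRe x - qRe y"
| "qIm1 (x - y) = qIm1 x - qIm1 y"
| "qIm2 (x - y) = qIm2 x - qIm2 y"
| "qIm3 (x - y) = qIm3 x - qIm3 y"

instance
  by standard (simp_all add: quat_eq_iff)

end

instantiation quat :: ring_1
begin

primcorec one_quat where
  "qRe 1 = 1" | "qIm1 1 = 0" | "qIm2 1 = 0" | "qIm3 1 = 0"

primcorec times_quat where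
  "qRe (x * y) = qRe x * qRe y - qIm1 x * qIm1 y - qIm2 x * qIm2 y - qIm3 x * qIm3 y"
| "qIm1 (x * y) = qRe x * qIm1 y + qIm1 x * qRe y + qIm2 x * qIm3 y - qIm3 x * qIm2 y"
| "qIm2 (x * y) = qRe x * qIm2 y - qIm1 x * qIm3 y + qIm2 x * qRe y + qIm3 x * qIm1 y"
| "qIm3 (x * y) = qRe x * qIm3 y + qIm1 x * qIm2 y - qIm2 x * qIm1 y + qIm3 x * qRe y"

instance
  by standard (simp_all add: quat_eq_iff algebra_simps)

end

lemma quat_sum_squares_eq_0_iff:
  "(qRe x)\<^sup>2 + (qIm1 x)\<^sup>2 + (qIm2 x)\<^sup>2 + (qIm3 x)\<^sup>2 = 0 \<longleftrightarrow> x = 0"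
  by (simp add: quat_eq_iff add_nonneg_eq_0_iff)

instantiation quat :: real_algebra_1
begin

primcorec scaleR_quat where
  "qRe (scaleR r x) = r * qRe x"
| "qIm1 (scaleR r x) = r * qIm1 x"
| "qIm2 (scaleR r x) = r * qIm2 x"
| "qIm3 (scaleR r x) = r * qIm3 x"

instance
  by standard (simp_all add: quat_eq_iff algebra_simps)

end

instantiation quat :: real_inner
begin

definition inner_quat_def:
  "inner x y = qRe x * qRe y + qIm1 x * qIm1 y + qIm2 x * qIm2 y + qIm3 x * qIm3 y"
definition norm_quat_def: "norm (x::quat) = sqrt (inner x x)"
definition sgn_quat_def: "sgn (x::quat) = x /\<^sub>R norm x"
definition dist_quat_def: "dist (x::quat) y = norm (x - y)"
definition uniformity_quat_def [code del]:
  "(uniformity :: (quat \<times> quat) filter) = (INF e\<in>{0<..}. principal {(x, y). dist x y < e})"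
definition open_quat_def [code del]:
  "open (U :: quat set) \<longleftrightarrow> (\<forall>x\<in>U. eventually (\<lambda>(x', y). x' = x \<longrightarrow> y \<in> U) uniformity)"

instance
proof
  fix x y z :: quat and r :: real and U :: "quat set"
  show "dist x y = norm (x - y)" by (rule dist_quat_def)
  show "sgn x = x /\<^sub>R norm x" by (rule sgn_quat_def)
  show "(uniformity :: (quat \<times> quat) filter) = (INF e\<in>{0<..}. principal {(x, y). dist x y < e})"
    by (rule uniformity_quat_def)
  show "open U \<longleftrightarrow> (\<forall>x\<in>U. eventually (\<lambda>(x', y). x' = x \<longrightarrow> y \<in> U) uniformity)"
    by (rule open_quat_def)
  show "inner x y = inner y x" by (simp add: inner_quat_def mult.commute)
  show "inner (x + y) z = inner x z + inner y z" by (simp add: inner_quat_def algebra_simps)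
  show "inner (r *\<^sub>R x) y = r * inner x y" by (simp add: inner_quat_def algebra_simps)
  show "0 \<le> inner x x" by (simp add: inner_quat_def)
  show "inner x x = 0 \<longleftrightarrow> x = 0"
    using quat_sum_squares_eq_0_iff[of x] unfolding inner_quat_def power2_eq_square .
  show "norm x = sqrt (inner x x)" by (rule norm_quat_def)
qed

end

lemma norm_quat_eq: "norm x = sqrt ((qRe x)\<^sup>2 + (qIm1 x)\<^sup>2 + (qIm2 x)\<^sup>2 + (qIm3 x)\<^sup>2)"
  by (simp add: norm_quat_def inner_quat_def power2_eq_square)

instantiation quat :: real_normed_div_algebra
begin

definition inverse_quat_def:
  "inverse x = Quat (qRe x) (- qIm1 x) (- qIm2 x) (- qIm3 x)
     /\<^sub>R ((qRe x)\<^sup>2 + (qIm1 x)\<^sup>2 + (qIm2 x)\<^sup>2 + (qIm3 x)\<^sup>2)"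
definition divide_quat_def: "x div y = x * inverse (y::quat)"

instance
proof
  fix x y :: quat
  let ?c = "\<lambda>x. Quat (qRe x) (- qIm1 x) (- qIm2 x) (- qIm3 x)"
  let ?s = "\<lambda>x. (qRe x)\<^sup>2 + (qIm1 x)\<^sup>2 + (qIm2 x)\<^sup>2 + (qIm3 x)\<^sup>2"
  have c: "?c x * x = ?s x *\<^sub>R 1" "x * ?c x = ?s x *\<^sub>R 1"
    by (simp_all add: quat_eq_iff power2_eq_square algebra_simps)
  show "inverse x * x = 1" "x * inverse x = 1" if "x \<noteq> 0"
    using that quat_sum_squares_eq_0_iff[of x] unfolding inverse_quat_def
    by (simp_all only: mult_scaleR_left mult_scaleR_right c scaleR_scaleR) simp_all
  show "x div y = x * inverse y" by (rule divide_quat_def)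
  show "inverse (0::quat) = 0" by (simp add: inverse_quat_def)
  have "?s (x * y) = ?s x * ?s y"
    by (simp add: power2_eq_square algebra_simps)
  then show "norm (x * y) = norm x * norm y"
    by (simp only: norm_quat_eq real_sqrt_mult)
qed

end

definition quat_i :: quat where "quat_i = Quat 0 1 0 0"
definition quat_j :: quat where "quat_j = Quat 0 0 1 0"
definition quat_k :: quat where "quat_k = Quat 0 0 0 1"

lemmas quat_unit_defs = quat_i_def quat_j_def quat_k_def

lemma quat_units_mult:
  "quat_i * quat_i = -1" "quat_j * quat_j = -1" "quat_k * quat_k = -1"
  "quat_i * quat_j = quat_k" "quat_j * quat_k = quat_i" "quat_k * quat_i = quat_j"
  "quat_j * quat_i = - quat_k" "quat_k * quat_j = - quat_i" "quat_i * quat_k = - quat_j"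
  by (simp_all add: quat_eq_iff quat_unit_defs)

instantiation quat :: euclidean_space
begin

definition Basis_quat_def: "Basis = {1, quat_i, quat_j, quat_k}"

instance
proof
  fix u v x :: quat
  show "(Basis :: quat set) \<noteq> {}" "finite (Basis :: quat set)"
    by (simp_all add: Basis_quat_def)
  show "inner u v = (if u = v then 1 else 0)" if "u \<in> Basis" "v \<in> Basis"
    using that unfolding Basis_quat_def
    by (elim insertE emptyE; simp add: inner_quat_def quat_unit_defs quat_eq_iff)
  show "(\<forall>u\<in>Basis. inner x u = 0) \<longleftrightarrow> x = 0"
    unfolding Basis_quat_def quat_eq_iff[of x]
    by (simp add: inner_quat_def quat_unit_defs)
qed

end

section \<open>Smooth maps and involutive distributions\<close>

text \<open>\<open>C\<^sup>k\<close> and smooth maps; intended for open \<open>S\<close> in a finite-dimensional space, where continuity of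
  all iterated directional derivatives is continuity of the iterated total derivatives.\<close>

primrec Ck_on :: "nat \<Rightarrow> 'a::euclidean_space set \<Rightarrow> ('a \<Rightarrow> 'b::real_normed_vector) \<Rightarrow> bool" where
  "Ck_on 0 S f \<longleftrightarrow> continuous_on S f"
| "Ck_on (Suc k) S f \<longleftrightarrow>
     (\<forall>x\<in>S. f differentiable (at x)) \<and> (\<forall>v. Ck_on k S (\<lambda>x. frechet_derivative f (at x) v))"

definition smooth_on :: "'a::euclidean_space set \<Rightarrow> ('a \<Rightarrow> 'b::real_normed_vector) \<Rightarrow> bool" where
  "smooth_on S f \<longleftrightarrow> (\<forall>k. Ck_on k S f)"

definition lie_bracket ::
    "('a::euclidean_space \<Rightarrow> 'a) \<Rightarrow> ('a \<Rightarrow> 'a) \<Rightarrow> 'a \<Rightarrow> 'a" where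
  "lie_bracket Y Z x = frechet_derivative Z (at x) (Y x) - frechet_derivative Y (at x) (Z x)"

definition smooth_section_on ::
    "'a::euclidean_space set \<Rightarrow> ('a \<Rightarrow> 'a set) \<Rightarrow> ('a \<Rightarrow> 'a) \<Rightarrow> bool" where
  "smooth_section_on V D Y \<longleftrightarrow> smooth_on V Y \<and> (\<forall>x\<in>V. Y x \<in> D x)"

definition involutive_on :: "'a::euclidean_space set \<Rightarrow> ('a \<Rightarrow> 'a set) \<Rightarrow> bool" where
  "involutive_on U D \<longleftrightarrow>
     (\<forall>V Y Z. open V \<longrightarrow> V \<subseteq> U \<longrightarrow> smooth_section_on V D Y \<longrightarrow> smooth_section_on V D Z \<longrightarrow>
        (\<forall>x\<in>V. lie_bracket Y Z x \<in> D x))"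

section \<open>Leaves of a distribution of real four-planes\<close>

text \<open>An immersed integral manifold is a subset of \<open>U\<close> carrying its own topology \<open>T\<close>, in general finer
  than the subspace topology. Its charts are \<open>T\<close>-homeomorphic smooth immersions of open subsets of
  \<open>\<real>\<^sup>4\<close> whose tangent spaces are the planes of \<open>D\<close>. Smoothness of the transition maps is automatic,
  since an immersion locally has a smooth left inverse.\<close>

definition integral_manifold ::
    "'a::euclidean_space set \<Rightarrow> ('a \<Rightarrow> 'a set) \<Rightarrow> 'a topology \<Rightarrow> bool" where
  "integral_manifold U D T \<longleftrightarrow>
     topspace T \<subseteq> U \<and> Hausdorff_space T \<and> second_countable T \<and>
     (\<forall>p\<in>topspace T. \<exists>(W :: (real^4) set) \<phi>.
        open W \<and> p \<in> \<phi> ` W \<and> openin T (\<phi> ` W) \<and>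
        homeomorphic_map (top_of_set W) (subtopology T (\<phi> ` W)) \<phi> \<and>
        smooth_on W \<phi> \<and>
        (\<forall>w\<in>W. inj (frechet_derivative \<phi> (at w)) \<and>
               range (frechet_derivative \<phi> (at w)) = D (\<phi> w)))"

definition connected_integral_manifold ::
    "'a::euclidean_space set \<Rightarrow> ('a \<Rightarrow> 'a set) \<Rightarrow> 'a topology \<Rightarrow> bool" where
  "connected_integral_manifold U D T \<longleftrightarrow>
     integral_manifold U D T \<and> connected_space T \<and> topspace T \<noteq> {}"

definition leaves :: "'a::euclidean_space set \<Rightarrow> ('a \<Rightarrow> 'a set) \<Rightarrow> 'a set set" where
  "leaves U D = {L. (\<exists>T. connected_integral_manifold U D T \<and> topspace T = L) \<and>
                    (\<forall>T. connected_integral_manifold U D T \<longrightarrow> L \<subseteq> topspace T \<longrightarrow> topspace T = L)}"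

definition induced_sphere_foliation ::
    "'a::euclidean_space set \<Rightarrow> ('a \<Rightarrow> 'a set) \<Rightarrow> 'a set set" where
  "induced_sphere_foliation U D = {L \<inter> sphere 0 1 | L. L \<in> leaves U D}"

section \<open>Quaternionic rank-one distributions and the Hopf foliation\<close>

definition rscale :: "quat^'n \<Rightarrow> quat \<Rightarrow> quat^'n" (infixl \<open>*q\<close> 75) where
  "x *q a = (\<chi> i. x $ i * a)"

lemma matrix_vector_mult_rscale: "A *v (q *q a) = (A *v q) *q a"
  by (simp add: vec_eq_iff rscale_def matrix_vector_mult_def sum_distrib_right mult.assoc)

definition quat_distribution :: "(quat^'n \<Rightarrow> quat^'n) \<Rightarrow> quat^'n \<Rightarrow> (quat^'n) set" where
  "quat_distribution X q = {X q *q a | a. True}"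

lemma quat_distribution_eq_span:
  "quat_distribution X q = span {X q, X q *q quat_i, X q *q quat_j, X q *q quat_k}"
proof
  have *: "x *q a = qRe a *\<^sub>R x + qIm1 a *\<^sub>R (x *q quat_i) + qIm2 a *\<^sub>R (x *q quat_j)
      + qIm3 a *\<^sub>R (x *q quat_k)" for x :: "quat^'n" and a
    by (simp add: vec_eq_iff rscale_def quat_eq_iff quat_unit_defs algebra_simps)
  show "quat_distribution X q \<subseteq> span {X q, X q *q quat_i, X q *q quat_j, X q *q quat_k}"
  proof
    fix v assume "v \<in> quat_distribution X q"
    then obtain a where "v = X q *q a"
      by (auto simp: quat_distribution_def)
    then show "v \<in> span {X q, X q *q quat_i, X q *q quat_j, X q *q quat_k}"
      by (simp only: *[of "X q" a]) (intro span_add span_scale span_base; simp)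
  qed
  have "subspace (quat_distribution X q)"
    unfolding subspace_def
  proof (intro conjI ballI allI)
    show "0 \<in> quat_distribution X q"
      by (auto simp: quat_distribution_def rscale_def vec_eq_iff intro!: exI[of _ 0])
  next
    fix x y assume "x \<in> quat_distribution X q" "y \<in> quat_distribution X q"
    then obtain a b where "x = X q *q a" "y = X q *q b"
      by (auto simp: quat_distribution_def)
    then have "x + y = X q *q (a + b)"
      by (simp add: rscale_def vec_eq_iff distrib_left)
    then show "x + y \<in> quat_distribution X q"
      by (auto simp: quat_distribution_def)
  next
    fix c x assume "x \<in> quat_distribution X q"
    then obtain a where "x = X q *q a"
      by (auto simp: quat_distribution_def)
    then have "c *\<^sub>R x = X q *q (c *\<^sub>R a)"
      by (simp add: rscale_def vec_eq_iff)
    then show "c *\<^sub>R x \<in> quat_distribution X q"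
      by (auto simp: quat_distribution_def)
  qed
  moreover have "X q *q a \<in> quat_distribution X q" for a
    by (auto simp: quat_distribution_def)
  moreover from this[of 1] have "X q \<in> quat_distribution X q"
    by (simp add: rscale_def)
  ultimately show "span {X q, X q *q quat_i, X q *q quat_j, X q *q quat_k} \<subseteq> quat_distribution X q"
    by (simp add: span_minimal)
qed

definition isolated_singularity :: "('a::euclidean_space \<Rightarrow> 'a) \<Rightarrow> 'a \<Rightarrow> bool" where
  "isolated_singularity X p \<longleftrightarrow> X p = 0 \<and> (\<forall>\<^sub>F q in at p. X q \<noteq> 0)"

text \<open>The group \<open>Sp(1)\<close> is the unit sphere of the quaternions.\<close>

definition hopf_foliation :: "(quat^'n) set set" where
  "hopf_foliation = {{q *q u | u. norm u = 1} | q. q \<in> sphere 0 1}"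

end

(* The linear sections A q i and A q j have bracket 2 A A q k, so involutivity of the distribution
   forces A p into p H for p = A q, that is, for every p because A is onto. A map for which every
   vector is a right eigenvector is a central scalar, hence a real one. Conversely, for A = \<mu> I the
   planes are the quaternionic lines q H, and a map tangent to them has locally constant projective
   coordinates; connected integral manifolds therefore lie in a single line, the leaves are the
   punctured lines, and these meet the unit sphere in the Hopf fibres. *)

theory Submission
  imports Defs
begin

section \<open>Right scalar multiplication on quaternionic vectors\<close>

lemma rscale_nth [simp]: "(x *q a) $ i = x $ i * a"
  by (simp add: rscale_def)

lemma rscale_rscale: "x *q a *q b = x *q (a * b)"
  by (simp add: vec_eq_iff mult.assoc)

lemma rscale_one [simp]: "x *q 1 = x"
  by (simp add: vec_eq_iff)

lemma norm_rscale: "norm (x *q a) = norm x * norm a"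
  by (simp add: norm_vec_def norm_mult L2_set_left_distrib)

lemma bounded_bilinear_rscale: "bounded_bilinear (\<lambda>(x::quat^'n) a. x *q a)"
proof
  show "\<exists>K. \<forall>(x::quat^'n) a. norm (x *q a) \<le> norm x * norm a * K"
    by (rule exI[of _ 1]) (simp add: norm_rscale)
qed (simp_all add: vec_eq_iff algebra_simps)

lemma rscale_eq_0_iff: "x *q a = 0 \<longleftrightarrow> x = 0 \<or> a = 0"
  using norm_rscale[of x a] by (metis mult_eq_0_iff norm_eq_zero)

lemma scaleR_rscale: "x *q (r *\<^sub>R 1) = r *\<^sub>R x"
  by (simp add: vec_eq_iff)

lemma linear_quat_matrix_vector_mult: "linear (\<lambda>q. (A::quat^'n^'m) *v q)"
  by (rule linearI)
    (simp_all add: matrix_vector_mult_def vec_eq_iff algebra_simps sum.distrib scaleR_right.sum)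

section \<open>Matrices for which every vector is a right eigenvector\<close>

lemma quat_central_imp_real:
  assumes "\<And>a::quat. c * a = a * c"
  shows "c = qRe c *\<^sub>R 1"
  \<comment> \<open>Commuting with \<open>quat_i\<close> kills the j and k parts, commuting with
    \<open>quat_j\<close> the i part.\<close>
  using assms[of quat_i] assms[of quat_j] by (simp add: quat_eq_iff quat_unit_defs)

text \<open>Unit vectors force \<open>A\<close> to be diagonal, and the vectors e_j + e_k a with j
  \<noteq> k force \<open>A $ k $ k * a = a * A $ j $ j\<close>. The choice a = 1 equates the
  diagonal entries; letting a vary makes their common value central. In dimension 1 every vector is
  a right eigenvector of every matrix, so two distinct indices are essential.\<close>

lemma quat_right_eigenvectors_imp_scalar:
  fixes A :: "quat^'n^'n"
  assumes card: "CARD('n) \<ge> 2"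
    and eigen: "\<And>p. p \<noteq> 0 \<Longrightarrow> \<exists>c. A *v p = p *q c"
  shows "\<exists>\<mu>::real. A = \<mu> *\<^sub>R mat 1"
proof -
  have entry: "(A *v (axis j 1 *q a)) $ i = A $ i $ j * a" for i j a
    by (simp add: matrix_vector_mult_rscale matrix_vector_mult_def axis_def if_distrib if_distribR
        cong: if_cong)
  have nonzero: "axis j (1::quat) + axis k 1 *q a \<noteq> 0" if "j \<noteq> k" for j k :: 'n and a
    using that by (auto simp: vec_eq_iff axis_def intro!: exI[of _ j])
  have off: "A $ i $ j = 0" if "i \<noteq> j" for i j
  proof -
    obtain c where "A *v axis j 1 = axis j 1 *q c"
      using eigen[of "axis j 1"] by (auto simp: axis_eq_0_iff)
    from arg_cong[OF this, of "\<lambda>v. v $ i"] show ?thesis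
      using entry[of j 1 i] that by (simp add: axis_def)
  qed
  have commute: "A $ k $ k * a = a * A $ j $ j" if jk: "j \<noteq> k" for j k a
  proof -
    obtain c where c: "A *v (axis j 1 + axis k 1 *q a) = (axis j 1 + axis k 1 *q a) *q c"
      using eigen[OF nonzero[OF jk]] by blast
    have row: "A $ i $ j + A $ i $ k * a = (axis j 1 $ i + axis k 1 $ i * a) * c" for i
      using arg_cong[OF c, of "\<lambda>v. v $ i"] entry[of j 1 i] entry[of k a i]
      by (simp add: matrix_vector_right_distrib)
    \<comment> \<open>Row j reads \<open>A $ j $ j = c\<close>, and row k reads
      \<open>A $ k $ k * a = a * c\<close>.\<close>
    show ?thesis
      using row[of j] row[of k] off[of j k] off[of k j] jk by (simp add: axis_def)
  qed
  obtain j k :: 'n where "j \<noteq> k"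
    using card card_le_Suc0_iff_eq[of "UNIV :: 'n set"] by fastforce
  have diag: "A $ l $ l = A $ j $ j" for l
    using commute[of j l 1] by (cases "l = j") auto
  have "A $ j $ j = qRe (A $ j $ j) *\<^sub>R 1"
    using commute[OF \<open>j \<noteq> k\<close>] diag[of k] by (intro quat_central_imp_real) metis
  then have "A = qRe (A $ j $ j) *\<^sub>R mat 1"
    using off diag by (auto simp: vec_eq_iff mat_def)
  then show ?thesis ..
qed

section \<open>Smoothness of linear maps\<close>

lemma Ck_on_const: "Ck_on k S (\<lambda>x. c)"
  by (induction k arbitrary: c) auto

lemma bounded_linear_frechet_derivative:
  "bounded_linear f \<Longrightarrow> frechet_derivative f (at x) = f"
  by (metis bounded_linear_imp_has_derivative frechet_derivative_at)

lemma bounded_linear_imp_smooth_on: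
  assumes "bounded_linear f"
  shows "smooth_on S f"
proof -
  have "Ck_on k S f" for k
  proof (cases k)
    case 0
    then show ?thesis
      using assms linear_continuous_on by auto
  next
    case (Suc l)
    then show ?thesis
      using assms bounded_linear_frechet_derivative[OF assms] bounded_linear_imp_differentiable
      by (auto simp: Ck_on_const)
  qed
  then show ?thesis
    by (simp add: smooth_on_def)
qed

lemma smooth_on_imp_has_derivative:
  assumes "smooth_on S f" "x \<in> S"
  shows "(f has_derivative frechet_derivative f (at x)) (at x)"
proof -
  have "Ck_on (Suc 0) S f"
    using assms by (simp only: smooth_on_def)
  then show ?thesis
    using assms by (simp flip: frechet_derivative_works)
qed

section \<open>Involutivity forces a real scalar\<close>

text \<open>The hypothesis is injectivity because both halves of the theorem reach it, one from an
  inverse matrix and the other from an isolated zero.\<close>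

lemma involutive_linear_imp_real_scalar:
  fixes A :: "quat^'n^'n"
  assumes "CARD('n) \<ge> 2"
    and inj: "inj (\<lambda>q. A *v q)"
    and inv: "involutive_on (- {0}) (quat_distribution (\<lambda>q. A *v q))"
  shows "\<exists>\<mu>::real. \<mu> \<noteq> 0 \<and> A = \<mu> *\<^sub>R mat 1"
proof -
  have linear: "linear (\<lambda>q. A *v q)"
    by (rule linear_quat_matrix_vector_mult)
  have surj: "surj (\<lambda>q. A *v q)"
    by (rule linear_injective_imp_surjective[OF linear inj refl])
  have section_linear: "bounded_linear (\<lambda>q. (A *v q) *q a)" for a
    by (rule bounded_linear_compose[OF bounded_bilinear.bounded_linear_left
            [OF bounded_bilinear_rscale]]) (use linear in \<open>simp add: linear_conv_bounded_linear\<close>)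
  have lin_section: "smooth_section_on (- {0}) (quat_distribution (\<lambda>q. A *v q)) (\<lambda>q. (A *v q) *q a)" for a
    using bounded_linear_imp_smooth_on[OF section_linear]
    by (auto simp: smooth_section_on_def quat_distribution_def)
  have "\<exists>c. A *v p = p *q c" if "p \<noteq> 0" for p
  proof -
    obtain q where q: "p = A *v q"
      using surj by (auto simp: surj_def)
    with that have "q \<noteq> 0"
      by auto
    then have "lie_bracket (\<lambda>q. (A *v q) *q quat_i) (\<lambda>q. (A *v q) *q quat_j) q
        \<in> quat_distribution (\<lambda>q. A *v q) q"
      using inv[unfolded involutive_on_def, rule_format, OF _ _ lin_section lin_section]
      by (simp add: open_Compl)
    then obtain c where c: "(A *v (p *q quat_i)) *q quat_j - (A *v (p *q quat_j)) *q quat_i = p *q c"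
      by (auto simp: lie_bracket_def bounded_linear_frechet_derivative[OF section_linear]
          quat_distribution_def q)
    \<comment> \<open>The bracket of the two linear sections is \<open>(A *v p) *q ?k\<close>,
      because i j = k and j i = -k. As \<open>?k * ?k' = 1\<close>, right multiplication by
      \<open>?k'\<close> recovers \<open>A *v p\<close>.\<close>
    let ?k = "2 *\<^sub>R quat_k" and ?k' = "- (1/2) *\<^sub>R quat_k"
    have "A *v p = (A *v p) *q ?k *q ?k'"
      by (simp add: rscale_rscale quat_units_mult)
    also have "(A *v p) *q ?k = (A *v (p *q quat_i)) *q quat_j - (A *v (p *q quat_j)) *q quat_i"
      by (simp add: matrix_vector_mult_rscale rscale_rscale quat_units_mult vec_eq_iff scaleR_2
          distrib_left)
    also note c
    finally show ?thesis
      unfolding rscale_rscale by (rule exI)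
  qed
  then obtain \<mu> where \<mu>: "A = \<mu> *\<^sub>R mat 1"
    using quat_right_eigenvectors_imp_scalar[OF assms(1), of A] by auto
  moreover have "\<mu> \<noteq> 0"
  proof
    assume "\<mu> = 0"
    \<comment> \<open>\<open>undefined\<close> stands for an arbitrary index.\<close>
    then have "A *v axis undefined 1 = A *v 0"
      by (simp add: \<mu>)
    then have "axis undefined (1::quat) = (0 :: quat^'n)"
      by (rule injD[OF inj])
    then show False
      by (simp add: axis_eq_0_iff)
  qed
  ultimately show ?thesis
    by blast
qed

section \<open>Quaternionic lines and their involutivity\<close>

text \<open>The distribution of the field X(q) = q, shared by all nonzero real multiples of the
  identity. At the origin it degenerates to {0}.\<close>

abbreviation quat_line :: "quat^'n \<Rightarrow> (quat^'n) set" where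
  "quat_line \<equiv> quat_distribution (\<lambda>q. q)"

lemma mem_quat_line_iff: "x \<in> quat_line q \<longleftrightarrow> (\<exists>a. x = q *q a)"
  by (simp add: quat_distribution_def)

lemma mem_quat_line_self: "q \<in> quat_line q"
  by (auto simp: mem_quat_line_iff intro: exI[of _ 1])

lemma quat_line_eq:
  assumes "x \<in> quat_line q" "x \<noteq> 0"
  shows "quat_line x = quat_line q"
proof -
  obtain a where a: "x = q *q a"
    using assms by (auto simp: mem_quat_line_iff)
  with assms have "a \<noteq> 0"
    by (auto simp: rscale_eq_0_iff)
  then have "q *q b = x *q (inverse a * b)" for b
    by (simp add: a rscale_rscale flip: mult.assoc)
  then have "q *q b \<in> quat_line x" for b
    unfolding mem_quat_line_iff by (rule exI)
  then have "quat_line q \<subseteq> quat_line x"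
    by (auto simp: mem_quat_line_iff[of _ q])
  moreover have "quat_line x \<subseteq> quat_line q"
    by (auto simp: a mem_quat_line_iff rscale_rscale)
  ultimately show ?thesis
    by blast
qed

text \<open>Any nonzero coordinate of \<open>q\<close> determines the coefficient, and the resulting
  formula can be differentiated in both \<open>q\<close> and \<open>x\<close>.\<close>

lemma quat_line_eqD:
  assumes "x \<in> quat_line q" "q $ m \<noteq> 0"
  shows "x = q *q (inverse (q $ m) * x $ m)"
proof -
  obtain a where "x = q *q a"
    using assms by (auto simp: mem_quat_line_iff)
  then show ?thesis
    using assms(2) by (simp flip: mult.assoc)
qed

text \<open>Left multiplication by the real \<mu> is also right multiplication by \<mu>, a nonzero
  factor that the line absorbs.\<close>

lemma quat_distribution_real_scalar:
  fixes A :: "quat^'n^'n"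
  assumes "A = \<mu> *\<^sub>R mat 1" "\<mu> \<noteq> 0"
  shows "quat_distribution (\<lambda>q. A *v q) = quat_line"
proof
  fix q :: "quat^'n"
  have "A *v q = \<mu> *\<^sub>R (mat 1 *v q)"
    by (simp add: assms(1) matrix_vector_mult_def vec_eq_iff scaleR_right.sum)
  then have "A *v q = q *q (\<mu> *\<^sub>R 1)"
    by (simp add: scaleR_rscale)
  then show "quat_distribution (\<lambda>q. A *v q) q = quat_line q"
    using \<open>\<mu> \<noteq> 0\<close> quat_line_eq[of "A *v q" q]
    by (cases "q = 0")
      (auto simp: quat_distribution_def rscale_eq_0_iff)
qed

text \<open>Near \<open>x\<close> the section factors as Y(q) = q a(q) with a differentiable at
  \<open>x\<close>, and the product rule at v = x b gives x (a'(v) + b a(x)). Hence each term of a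
  Lie bracket of sections lies in the line separately.\<close>

lemma derivative_section_quat_line:
  fixes Y :: "quat^'n \<Rightarrow> quat^'n"
  assumes "open V" "x \<in> V" "x \<noteq> 0" and Y: "smooth_section_on V quat_line Y"
    and v: "v \<in> quat_line x"
  shows "frechet_derivative Y (at x) v \<in> quat_line x"
proof -
  obtain m where m: "x $ m \<noteq> 0"
    using \<open>x \<noteq> 0\<close> by (auto simp: vec_eq_iff)
  obtain b where b: "v = x *q b"
    using v by (auto simp: mem_quat_line_iff)
  define Y' where "Y' = frechet_derivative Y (at x)"
  have Y': "(Y has_derivative Y') (at x)"
    using Y \<open>x \<in> V\<close> unfolding Y'_def
    by (auto simp: smooth_section_on_def intro: smooth_on_imp_has_derivative)
  define a where "a q = inverse (q $ m) * Y q $ m" for q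
  note nth = bounded_linear.has_derivative[OF bounded_linear_vec_nth]
  obtain a' where a': "(a has_derivative a') (at x)"
    using has_derivative_mult[OF Deriv.has_derivative_inverse[OF m nth[OF has_derivative_ident]]
        nth[OF Y']]
    unfolding a_def by blast
  \<comment> \<open>On \<open>?W\<close> the coordinate \<open>m\<close> stays nonzero, so there
    \<open>q *q a q\<close> agrees with \<open>Y q\<close>.\<close>
  let ?W = "V \<inter> {q. q $ m \<noteq> 0}"
  have "open ?W"
    using \<open>open V\<close> by (intro open_Int open_Collect_neq continuous_intros)
  have "((\<lambda>q. q *q a q) has_derivative (\<lambda>h. x *q a' h + h *q a x)) (at x)"
    by (rule bounded_bilinear.FDERIV[OF bounded_bilinear_rscale has_derivative_ident a'])
  then have "(Y has_derivative (\<lambda>h. x *q a' h + h *q a x)) (at x)"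
    by (rule has_derivative_transform_within_open[OF _ \<open>open ?W\<close>])
      (use Y m \<open>x \<in> V\<close> in \<open>auto simp: a_def smooth_section_on_def simp flip: quat_line_eqD\<close>)
  then have "Y' v = x *q a' v + v *q a x"
    using has_derivative_unique[OF Y'] by metis
  also have "\<dots> = x *q (a' v + b * a x)"
    by (simp add: b rscale_rscale bounded_bilinear.add_right[OF bounded_bilinear_rscale])
  finally show ?thesis
    by (auto simp: Y'_def mem_quat_line_iff)
qed

lemma subspace_quat_line: "subspace (quat_line q)"
  by (simp add: quat_distribution_eq_span subspace_span)

lemma involutive_quat_line: "involutive_on (- {0}) quat_line"
  unfolding involutive_on_def lie_bracket_def
  by (intro allI impI ballI subspace_diff[OF subspace_quat_line] derivative_section_quat_line)
    (auto simp: smooth_section_on_def)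

section \<open>The leaves as punctured quaternionic lines\<close>

text \<open>Carries the countable base of the type class over to the predicate that occurs in
  \<open>integral_manifold\<close>.\<close>

lemma second_countable_euclidean:
  "second_countable (euclidean :: 'a::second_countable_topology topology)"
proof -
  obtain B :: "'a set set" where B: "countable B" "\<And>C. C \<in> B \<Longrightarrow> open C"
    "\<And>S. open S \<Longrightarrow> \<exists>U. U \<subseteq> B \<and> S = \<Union>U"
    by (rule univ_second_countable) blast
  have "\<exists>V\<in>B. x \<in> V \<and> V \<subseteq> U" if "open U" "x \<in> U" for U x
    using B(3)[OF \<open>open U\<close>] \<open>x \<in> U\<close> by auto
  then show ?thesis
    using B unfolding second_countable_def by (intro exI[of _ B]) auto
qed

text \<open>A single linear chart, taking w to q f(w) with f a real isomorphism from
  \<open>real^4\<close> to the quaternions, covers the punctured line from the punctured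
  \<open>real^4\<close>. Dividing by a nonzero coordinate of \<open>q\<close> gives its continuous
  inverse.\<close>

lemma connected_integral_manifold_quat_line:
  fixes q :: "quat^'n"
  assumes "q \<noteq> 0"
  shows "connected_integral_manifold (- {0}) quat_line (top_of_set (quat_line q - {0}))"
proof -
  obtain m where m: "q $ m \<noteq> 0"
    using \<open>q \<noteq> 0\<close> by (auto simp: vec_eq_iff)
  have "DIM(real^4) = DIM(quat)"
    by (simp add: Basis_quat_def quat_unit_defs quat_eq_iff)
  then obtain f :: "real^4 \<Rightarrow> quat" and g
    where f: "linear f" and g: "linear g" and gf: "\<And>x. g (f x) = x" and fg: "\<And>x. f (g x) = x"
    by (rule isomorphisms_UNIV_UNIV) blast
  define \<phi> where "\<phi> w = q *q f w" for w
  define \<psi> where "\<psi> x = g (inverse (q $ m) * x $ m)" for x :: "quat^'n"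
  have \<phi>: "bounded_linear \<phi>"
    unfolding \<phi>_def
    by (rule bounded_linear_compose[OF bounded_bilinear.bounded_linear_right
            [OF bounded_bilinear_rscale]]) (use f in \<open>simp add: linear_conv_bounded_linear\<close>)
  have \<psi>: "continuous_on S \<psi>" for S
    unfolding \<psi>_def using g
    by (intro continuous_on_compose2[OF linear_continuous_on[of g UNIV]] continuous_intros)
      (auto simp: linear_conv_bounded_linear)
  have \<psi>\<phi>: "\<psi> (\<phi> w) = w" for w
    using m by (simp add: \<phi>_def \<psi>_def gf flip: mult.assoc)
  have \<phi>\<psi>: "\<phi> (\<psi> x) = x" if "x \<in> quat_line q" for x
    using quat_line_eqD[OF that m] by (simp add: \<phi>_def \<psi>_def fg)
  have range: "range \<phi> = quat_line q"
    using \<phi>\<psi> by (auto simp: \<phi>_def mem_quat_line_iff) (metis rangeI)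
  have "inj \<phi>"
    using \<psi>\<phi> by (metis injI)
  have "\<phi> 0 = 0"
    using \<phi> by (rule linear_simps)
  with range \<open>inj \<phi>\<close> have image: "\<phi> ` (- {0}) = quat_line q - {0}"
    by (metis Compl_eq_Diff_UNIV image_empty image_insert image_set_diff)
  \<comment> \<open>The derivative of the linear chart is the chart itself, with range
    \<open>quat_line q\<close>; this identity makes that range the plane at every image
    point.\<close>
  have line: "quat_line (\<phi> w) = quat_line q" if "w \<noteq> 0" for w
    using image that by (intro quat_line_eq) auto
  let ?L = "quat_line q - {0}"
  have "homeomorphic_maps (top_of_set (- {0})) (top_of_set ?L) \<phi> \<psi>"
    unfolding homeomorphic_maps_def
    using image \<psi> \<psi>\<phi> \<phi>\<psi> linear_continuous_on[OF \<phi>]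
    by (auto simp: image_iff) (metis \<phi>\<psi> \<open>\<phi> 0 = 0\<close>)
  then have homeo: "homeomorphic_map (top_of_set (- {0})) (top_of_set ?L) \<phi>"
    by (metis homeomorphic_map_maps)
  have "connected (- {0::real^4})"
    by (intro connected_punctured_universe) simp
  then have "connected ?L"
    using linear_continuous_on[OF \<phi>] connected_continuous_image image by metis
  moreover have "integral_manifold (- {0}) quat_line (top_of_set ?L)"
    unfolding integral_manifold_def
  proof (intro conjI ballI)
    show "Hausdorff_space (top_of_set ?L)"
      by (simp add: Hausdorff_space_subtopology)
    show "second_countable (top_of_set ?L)"
      by (simp add: second_countable_subtopology second_countable_euclidean)
    fix p assume "p \<in> topspace (top_of_set ?L)"
    then show "\<exists>(W :: (real^4) set) \<phi>.
        open W \<and> p \<in> \<phi> ` W \<and> openin (top_of_set ?L) (\<phi> ` W) \<and>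
        homeomorphic_map (top_of_set W) (subtopology (top_of_set ?L) (\<phi> ` W)) \<phi> \<and>
        smooth_on W \<phi> \<and>
        (\<forall>w\<in>W. inj (frechet_derivative \<phi> (at w)) \<and>
               range (frechet_derivative \<phi> (at w)) = quat_line (\<phi> w))"
      using image homeo bounded_linear_imp_smooth_on[OF \<phi>] \<open>inj \<phi>\<close> range line
      by (intro exI[of _ "- {0}"] exI[of _ \<phi>])
        (auto simp: bounded_linear_frechet_derivative[OF \<phi>] subtopology_subtopology)
  qed auto
  moreover have "?L \<noteq> {}"
    using \<open>q \<noteq> 0\<close> mem_quat_line_self by blast
  ultimately show ?thesis
    by (simp add: connected_integral_manifold_def connected_space_subtopology)
qed

text \<open>The projective coordinates \<open>\<phi>\<^sub>i \<phi>\<^sub>m\<inverse>\<close> of a map tangent to the lines have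
  vanishing derivative.\<close>

lemma tangent_quat_line_locally_constant:
  fixes \<phi> :: "'a::euclidean_space \<Rightarrow> quat^'n"
  assumes "open W" "w0 \<in> W" "\<phi> w0 \<noteq> 0"
    and deriv: "\<And>w. w \<in> W \<Longrightarrow> (\<phi> has_derivative \<phi>' w) (at w)"
    and tangent: "\<And>w v. w \<in> W \<Longrightarrow> \<phi>' w v \<in> quat_line (\<phi> w)"
  obtains e where "e > 0" "ball w0 e \<subseteq> W" "\<phi> ` ball w0 e \<subseteq> quat_line (\<phi> w0)"
proof -
  obtain m where m: "\<phi> w0 $ m \<noteq> 0"
    using \<open>\<phi> w0 \<noteq> 0\<close> by (auto simp: vec_eq_iff)
  have "continuous_on W \<phi>"
    by (intro continuous_at_imp_continuous_on ballI has_derivative_continuous[OF deriv])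
  then have "open (W \<inter> (\<lambda>w. \<phi> w $ m) -` (- {0}))"
    using \<open>open W\<close> by (intro continuous_open_preimage continuous_intros) auto
  then have "\<exists>e>0. ball w0 e \<subseteq> W \<inter> (\<lambda>w. \<phi> w $ m) -` (- {0})"
    by (rule open_contains_ball[THEN iffD1, THEN bspec]) (simp add: m \<open>w0 \<in> W\<close>)
  then obtain e where e: "e > 0" "ball w0 e \<subseteq> W \<inter> (\<lambda>w. \<phi> w $ m) -` (- {0})"
    by blast
  \<comment> \<open>On the ball, \<open>F w\<close> is the representative of the line through
    \<open>\<phi> w\<close> whose \<open>m\<close>-th coordinate is 1, so constancy of
    \<open>F\<close> means constancy of the line.\<close>
  define F where "F w = \<phi> w *q inverse (\<phi> w $ m)" for w
  have F': "(F has_derivative (\<lambda>h. 0)) (at w)" if "w \<in> ball w0 e" for w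
  proof -
    have w: "w \<in> W" "\<phi> w $ m \<noteq> 0"
      using that e by auto
    let ?i = "inverse (\<phi> w $ m)"
    have "(F has_derivative
        (\<lambda>h. \<phi> w *q (- (?i * (\<phi>' w h $ m) * ?i)) + \<phi>' w h *q ?i)) (at w)"
      unfolding F_def
      by (intro bounded_bilinear.FDERIV[OF bounded_bilinear_rscale] deriv w Deriv.has_derivative_inverse
          bounded_linear.has_derivative[OF bounded_linear_vec_nth])
    \<comment> \<open>Tangency expresses \<open>\<phi>' w h\<close> as a multiple of
      \<open>\<phi> w\<close> through its \<open>m\<close>-th coordinate; a further right factor
      \<open>?i\<close> makes it cancel the term from differentiating the inverse.\<close>
    moreover have "\<phi> w *q (- (?i * (\<phi>' w h $ m) * ?i)) + \<phi>' w h *q ?i = 0" for h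
    proof -
      have "\<phi>' w h *q ?i = \<phi> w *q (?i * (\<phi>' w h $ m) * ?i)"
        using arg_cong[OF quat_line_eqD[OF tangent[OF w(1), of h] w(2)], of "\<lambda>x. x *q ?i"]
        unfolding rscale_rscale .
      then show ?thesis
        by (simp add: bounded_bilinear.minus_right[OF bounded_bilinear_rscale])
    qed
    ultimately show ?thesis
      by simp
  qed
  have "\<exists>c. \<forall>w\<in>ball w0 e. F w = c"
    by (rule has_derivative_zero_constant[OF convex_ball has_derivative_at_withinI[OF F']])
  then obtain c where c: "\<And>w. w \<in> ball w0 e \<Longrightarrow> F w = c"
    by blast
  have "\<phi> w \<in> quat_line (\<phi> w0)" if "w \<in> ball w0 e" for w
  proof -
    have "\<phi> w $ m \<noteq> 0"
      using that e by auto
    then have "\<phi> w = F w *q (\<phi> w $ m)"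
      by (simp add: F_def rscale_rscale)
    also have "F w = F w0"
      using c that \<open>e > 0\<close> by simp
    finally show ?thesis
      by (auto simp: F_def rscale_rscale mem_quat_line_iff)
  qed
  with e show thesis
    by (intro that[of e]) auto
qed

text \<open>A chart maps a small ball into one line and is a homeomorphism onto a
  \<open>T\<close>-open set, so the image of the ball is a \<open>T\<close>-open neighbourhood of
  \<open>p\<close>. This holds even where \<open>T\<close> is finer than the subspace
  topology.\<close>

lemma integral_manifold_quat_line_locally:
  fixes T :: "(quat^'n) topology"
  assumes "integral_manifold (- {0}) quat_line T" "p \<in> topspace T"
  obtains U where "openin T U" "p \<in> U" "U \<subseteq> quat_line p"
proof -
  obtain W :: "(real^4) set" and \<phi> where W: "open W" "p \<in> \<phi> ` W" "openin T (\<phi> ` W)"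
    and homeo: "homeomorphic_map (top_of_set W) (subtopology T (\<phi> ` W)) \<phi>"
    and smooth: "smooth_on W \<phi>"
    and range: "\<And>w. w \<in> W \<Longrightarrow> range (frechet_derivative \<phi> (at w)) = quat_line (\<phi> w)"
    using assms unfolding integral_manifold_def by meson
  obtain w0 where w0: "w0 \<in> W" "p = \<phi> w0"
    using W by auto
  have "p \<noteq> 0"
    using assms by (auto simp: integral_manifold_def)
  then obtain e where e: "e > 0" "ball w0 e \<subseteq> W" "\<phi> ` ball w0 e \<subseteq> quat_line (\<phi> w0)"
    using tangent_quat_line_locally_constant[of W w0 \<phi> "\<lambda>w. frechet_derivative \<phi> (at w)"] W w0
      smooth_on_imp_has_derivative[OF smooth] range by (metis rangeI)
  have "openin (subtopology T (\<phi> ` W)) (\<phi> ` ball w0 e)"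
    using homeomorphic_map_openness[OF homeo, of "ball w0 e"] e W
    by (simp add: openin_open_eq)
  then have "openin T (\<phi> ` ball w0 e)"
    using W(3) openin_trans_full by blast
  then show thesis
    using that e w0 by auto
qed

text \<open>The map from x to \<open>quat_line x\<close> is locally constant for \<open>T\<close>,
  hence constant by connectedness.\<close>

lemma connected_integral_manifold_subset_quat_line:
  fixes T :: "(quat^'n) topology"
  assumes T: "connected_integral_manifold (- {0}) quat_line T" and q: "q \<in> topspace T"
  shows "topspace T \<subseteq> quat_line q - {0}"
proof -
  have im: "integral_manifold (- {0}) quat_line T" and conn: "connected_space T"
    using T by (auto simp: connected_integral_manifold_def)
  have nonzero: "x \<noteq> 0" if "x \<in> topspace T" for x
    using im that by (auto simp: integral_manifold_def)
  \<comment> \<open>The arbitrary predicate \<open>P\<close> treats a level set of this map and its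
    complement at once.\<close>
  have "openin T {x \<in> topspace T. P (quat_line x)}" for P
  proof (subst openin_subopen, intro ballI)
    fix x assume x: "x \<in> {x \<in> topspace T. P (quat_line x)}"
    then obtain U where U: "openin T U" "x \<in> U" "U \<subseteq> quat_line x"
      using integral_manifold_quat_line_locally[OF im, of x] by auto
    have "U \<subseteq> topspace T"
      using U(1) by (rule openin_subset)
    have "P (quat_line y)" if "y \<in> U" for y
    proof -
      have "y \<in> quat_line x" "y \<noteq> 0"
        using that U(3) \<open>U \<subseteq> topspace T\<close> nonzero[of y] by auto
      then show ?thesis
        using x by (simp add: quat_line_eq)
    qed
    with U x \<open>U \<subseteq> topspace T\<close>
    show "\<exists>U. openin T U \<and> x \<in> U \<and> U \<subseteq> {x \<in> topspace T. P (quat_line x)}"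
      by (intro exI[of _ U]) auto
  qed
  note pieces = this[of "\<lambda>l. l = quat_line q"] this[of "\<lambda>l. l \<noteq> quat_line q"]
  let ?E = "{x \<in> topspace T. quat_line x = quat_line q}"
    and ?F = "{x \<in> topspace T. quat_line x \<noteq> quat_line q}"
  have "topspace T \<subseteq> ?E \<union> ?F" "?E \<inter> ?F = {}" "?E \<noteq> {}"
    using q by auto
  then have "?F = {}"
    using conn pieces unfolding connected_space_def by meson
  have "x \<in> quat_line q" if "x \<in> topspace T" for x
  proof -
    have "quat_line x = quat_line q"
      using \<open>?F = {}\<close> that by blast
    then show ?thesis
      using mem_quat_line_self[of x] by simp
  qed
  then show ?thesis
    using nonzero by auto
qed

text \<open>A connected integral manifold lies in the punctured line through any of its points, and
  that punctured line is itself one. So a maximal manifold fills its line, and no manifold properly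
  contains a punctured line.\<close>

lemma leaves_quat_line: "leaves (- {0}) quat_line = {quat_line q - {0} | q. q \<noteq> 0}"
proof (intro equalityI subsetI)
  fix L :: "(quat^'n) set"
  assume "L \<in> leaves (- {0}) quat_line"
  then obtain T where T: "connected_integral_manifold (- {0}) quat_line T" "topspace T = L"
    and max: "\<And>T. connected_integral_manifold (- {0}) quat_line T \<Longrightarrow> L \<subseteq> topspace T \<Longrightarrow> topspace T = L"
    by (auto simp: leaves_def)
  then obtain q where "q \<in> L"
    by (auto simp: connected_integral_manifold_def)
  then have sub: "L \<subseteq> quat_line q - {0}"
    using connected_integral_manifold_subset_quat_line T by blast
  with \<open>q \<in> L\<close> have "q \<noteq> 0"
    by auto
  with max[OF connected_integral_manifold_quat_line[OF this]] sub
  show "L \<in> {quat_line q - {0} | q. q \<noteq> 0}"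
    by auto
next
  fix L :: "(quat^'n) set"
  assume "L \<in> {quat_line q - {0} | q. q \<noteq> 0}"
  then obtain q where q: "q \<noteq> 0" "L = quat_line q - {0}"
    by blast
  then have "q \<in> L"
    by (simp add: mem_quat_line_self)
  then have "topspace T = L" if "connected_integral_manifold (- {0}) quat_line T" "L \<subseteq> topspace T" for T
    using connected_integral_manifold_subset_quat_line[OF that(1), of q] that(2) q by blast
  then show "L \<in> leaves (- {0}) quat_line"
    using connected_integral_manifold_quat_line[OF q(1)] q(2)
    by (auto simp: leaves_def intro!: exI[of _ "top_of_set L"])
qed

section \<open>Intersection with the unit sphere\<close>

lemma quat_line_Int_sphere:
  assumes "norm q = 1"
  shows "(quat_line q - {0}) \<inter> sphere 0 1 = {q *q u | u. norm u = 1}"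
  using assms by (force simp: mem_quat_line_iff norm_rscale rscale_eq_0_iff)

lemma induced_sphere_foliation_quat_line:
  "induced_sphere_foliation (- {0}) quat_line = (hopf_foliation :: (quat^'n) set set)"
proof (intro equalityI subsetI)
  fix S :: "(quat^'n) set"
  assume "S \<in> induced_sphere_foliation (- {0}) quat_line"
  then obtain q where q: "q \<noteq> 0" "S = (quat_line q - {0}) \<inter> sphere 0 1"
    by (auto simp: induced_sphere_foliation_def leaves_quat_line)
  \<comment> \<open>Hopf fibres need a unit base point; normalising \<open>q\<close> keeps its
    line.\<close>
  let ?r = "q *q (inverse (norm q) *\<^sub>R 1)"
  have r: "norm ?r = 1"
    using q by (simp add: norm_rscale)
  then have "quat_line ?r = quat_line q"
    by (intro quat_line_eq) (auto simp: mem_quat_line_iff)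
  then have "S = {?r *q u | u. norm u = 1}"
    using q(2) quat_line_Int_sphere[OF r] by simp
  then show "S \<in> hopf_foliation"
    unfolding hopf_foliation_def mem_Collect_eq by (intro exI[of _ ?r] conjI) (simp_all add: r)
next
  fix S :: "(quat^'n) set"
  assume "S \<in> hopf_foliation"
  then obtain q where q: "norm q = 1" "S = {q *q u | u. norm u = 1}"
    unfolding hopf_foliation_def by auto
  then have "S = (quat_line q - {0}) \<inter> sphere 0 1"
    by (simp add: quat_line_Int_sphere)
  moreover have "q \<noteq> 0"
    using q(1) by auto
  ultimately show "S \<in> induced_sphere_foliation (- {0}) quat_line"
    unfolding induced_sphere_foliation_def leaves_quat_line by blast
qed

section \<open>Injectivity criteria and conclusion\<close>

text \<open>By homogeneity a nonzero kernel vector rescales to norm \<open>e / 2\<close>, giving a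
  second zero inside the isolating ball.\<close>

lemma linear_isolated_zero_imp_inj:
  fixes f :: "'a::euclidean_space \<Rightarrow> 'a"
  assumes "linear f" "isolated_singularity f 0"
  shows "inj f"
proof -
  obtain e where e: "e > 0" "\<And>x. x \<noteq> 0 \<Longrightarrow> norm x < e \<Longrightarrow> f x \<noteq> 0"
    using assms(2) by (auto simp: isolated_singularity_def eventually_at dist_norm)
  have "x = 0" if "f x = 0" for x
  proof (rule ccontr)
    assume "x \<noteq> 0"
    moreover have "f ((e / 2 / norm x) *\<^sub>R x) = 0"
      using assms(1) that by (simp add: linear_cmul)
    ultimately show False
      using e(2)[of "(e / 2 / norm x) *\<^sub>R x"] \<open>e > 0\<close> by simp
  qed
  then show ?thesis
    using linear_injective_0[OF assms(1)] by blast
qed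

lemma invertible_imp_inj_matrix_vector_mult:
  fixes A :: "'a::semiring_1^'n^'m"
  assumes "invertible A"
  shows "inj (\<lambda>q. A *v q)"
  using assms unfolding invertible_def
  by (metis injI matrix_vector_mul_assoc matrix_vector_mul_lid)

theorem theorem15p25:
  fixes A :: "quat^'n^'n"
  assumes "CARD('n) \<ge> 2"
  shows "(invertible A \<longrightarrow>
            (involutive_on (- {0}) (quat_distribution (\<lambda>q. A *v q)) \<longleftrightarrow>
             (\<exists>\<mu>::real. \<mu> \<noteq> 0 \<and> A = \<mu> *\<^sub>R mat 1))) \<and>
         (isolated_singularity (\<lambda>q. A *v q) 0 \<longrightarrow>
            involutive_on (- {0}) (quat_distribution (\<lambda>q. A *v q)) \<longrightarrow>
            induced_sphere_foliation (- {0}) (quat_distribution (\<lambda>q. A *v q)) = hopf_foliation)"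
proof (intro conjI impI)
  assume "invertible A"
  then have "inj (\<lambda>q. A *v q)"
    by (rule invertible_imp_inj_matrix_vector_mult)
  then show "involutive_on (- {0}) (quat_distribution (\<lambda>q. A *v q)) \<longleftrightarrow>
      (\<exists>\<mu>::real. \<mu> \<noteq> 0 \<and> A = \<mu> *\<^sub>R mat 1)"
    using involutive_linear_imp_real_scalar[OF assms, of A] quat_distribution_real_scalar[of A]
      involutive_quat_line by auto
next
  assume "isolated_singularity (\<lambda>q. A *v q) 0"
  then have "inj (\<lambda>q. A *v q)"
    by (rule linear_isolated_zero_imp_inj[OF linear_quat_matrix_vector_mult])
  moreover assume "involutive_on (- {0}) (quat_distribution (\<lambda>q. A *v q))"
  \<comment> \<open>The isolated zero and involutivity already make \<open>A\<close> a real scalar,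
    so the foliation only has to be computed for the lines themselves.\<close>
  ultimately obtain \<mu> :: real where "\<mu> \<noteq> 0" "A = \<mu> *\<^sub>R mat 1"
    using involutive_linear_imp_real_scalar[OF assms] by blast
  then have "quat_distribution (\<lambda>q. A *v q) = quat_line"
    by (intro quat_distribution_real_scalar)
  then show "induced_sphere_foliation (- {0}) (quat_distribution (\<lambda>q. A *v q)) = hopf_foliation"
    by (simp only: induced_sphere_foliation_quat_line)
qed

end
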